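(* Let $k$ be a positive integer and let $D\in\{5k,5k+2\}$. Then for each integer $n\geq D+1$ there exists a graph $G$ with $n$ vertices and diameter $D$ such that $$\dim_2(G)=n-D-1+\left\lfloor\frac{2D+4}{5}\right\rfloor .$$
   Context: All graphs are finite and simple; the diameter of a graph is the maximum distance between two of its vertices (so a graph of finite diameter $D$ is connected). For a graph $G$ and vertices $x,y\in V(G)$, put $a_G(x,y)=0$ if $x=y$, $a_G(x,y)=1$ if $x$ and $y$ are adjacent, and $a_G(x,y)=2$ otherwise. For a set $W=\{w_1,\ldots,w_m\}\subseteq V(G)$ and a vertex $v\in V(G)$, the adjacency representation of $v$ with respect to $W$ is the $m$-vector $r_2(v|W)=(a_G(v,w_1),\ldots,a_G(v,w_m))$. The set $W$ is an adjacency resolving set for $G$ if the vectors $r_2(v|W)$, $v\in V(G)$, are pairwise distinct. The adjacency dimension $\dim_2(G)$ is the minimum cardinality of an adjacency resolving set for $G$. *)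

theory Defs
  imports Graph_Theory.Graph_Theory "HOL-Library.FuncSet"
begin

text \<open>
  A finite simple graph is a \<^locale>\<open>pair_graph\<close>: an edge \<open>xy\<close> is
  the pair of arcs \<open>(x, y)\<close>, \<open>(y, x)\<close>.
\<close>

text \<open>
  Distances are extended reals: the least number of arcs of a walk, and \<open>\<infinity>\<close> if there is no walk.
  Hence the diameter of a disconnected graph is \<open>\<infinity>\<close>; for finite nonempty graphs
  the supremum is a maximum.
\<close>

definition graph_dist :: "'a pair_pre_digraph \<Rightarrow> 'a \<Rightarrow> 'a \<Rightarrow> ereal" where
  "graph_dist G x y = wf_digraph.\<mu> (with_proj G) (\<lambda>_. 1) x y"

definition diameter :: "'a pair_pre_digraph \<Rightarrow> ereal" where
  "diameter G = (SUP (x, y) \<in> pverts G \<times> pverts G. graph_dist G x y)"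

definition adj_code :: "'a pair_pre_digraph \<Rightarrow> 'a \<Rightarrow> 'a \<Rightarrow> nat" where
  "adj_code G x y = (if x = y then 0 else if (x, y) \<in> parcs G then 1 else 2)"

text \<open>The adjacency representation \<open>r\<^sub>2(v|W)\<close> is a vector indexed by \<open>W\<close> itself,
  so no enumeration of \<open>W\<close> has to be chosen.\<close>

definition adj_rep :: "'a pair_pre_digraph \<Rightarrow> 'a set \<Rightarrow> 'a \<Rightarrow> 'a \<Rightarrow> nat" where
  "adj_rep G W v = (\<lambda>w\<in>W. adj_code G v w)"

definition adj_resolving :: "'a pair_pre_digraph \<Rightarrow> 'a set \<Rightarrow> bool" where
  "adj_resolving G W \<longleftrightarrow> W \<subseteq> pverts G \<and> inj_on (adj_rep G W) (pverts G)"

definition adj_dim :: "'a pair_pre_digraph \<Rightarrow> nat" where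
  "adj_dim G = (LEAST m. \<exists>W. adj_resolving G W \<and> card W = m)"

end

theory Submission
  imports Defs
begin

text \<open>
  The graph is a broom: a path \<open>0, 1, \<dots>, D\<close> whose end \<open>0\<close> is replaced by \<open>n - D\<close> leaves attached
  to \<open>1\<close>.  The leaves are twins, so a resolving set \<open>W\<close> misses at most one of them.  The vertices
  outside \<open>W\<close>, with \<open>1\<close> ignored, have distinct neighbourhoods inside \<open>S = W \<inter> {1..D}\<close>: at most one
  is empty and at most \<open>card S\<close> are singletons, while every element of \<open>S\<close> lies in at most two of
  them.  Double counting bounds \<open>card S\<close> from below, and this is attained by the path vertices
  congruent to 2 or 4 modulo 5.
\<close>

section \<open>Adjacency resolving sets\<close>

text \<open>The entry 0 identifies every vertex of \<open>W\<close> by itself, so collisions are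
  possible only outside \<open>W\<close>. There all entries are 1 or 2, and the vector carries the
  same information as the neighbourhood in \<open>W\<close>.\<close>

lemma adj_resolving_iff_inj_on_nbhd:
  assumes "W \<subseteq> pverts G"
  shows "adj_resolving G W \<longleftrightarrow> inj_on (\<lambda>v. {w \<in> W. (v, w) \<in> parcs G}) (pverts G - W)"
proof -
  have rep_eq: "adj_rep G W u = adj_rep G W v \<longleftrightarrow> (\<forall>w\<in>W. adj_code G u w = adj_code G v w)" for u v
    unfolding adj_rep_def by (auto simp: restrict_def fun_eq_iff)
  have outside: "adj_rep G W u = adj_rep G W v \<longleftrightarrow>
      {w \<in> W. (u, w) \<in> parcs G} = {w \<in> W. (v, w) \<in> parcs G}" if "u \<notin> W" "v \<notin> W" for u v
  proof -
    have "adj_code G u w = adj_code G v w \<longleftrightarrow> ((u, w) \<in> parcs G \<longleftrightarrow> (v, w) \<in> parcs G)"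
      if "w \<in> W" for w
      using that \<open>u \<notin> W\<close> \<open>v \<notin> W\<close> by (auto simp: adj_code_def)
    then show ?thesis unfolding rep_eq by auto
  qed
  have inside: "u = v" if "adj_rep G W u = adj_rep G W v" "u \<in> W \<or> v \<in> W" for u v
    using that unfolding rep_eq by (auto simp: adj_code_def split: if_splits)
  show ?thesis
  proof
    assume "adj_resolving G W"
    then have inj: "inj_on (adj_rep G W) (pverts G)" by (simp add: adj_resolving_def)
    show "inj_on (\<lambda>v. {w \<in> W. (v, w) \<in> parcs G}) (pverts G - W)"
    proof (rule inj_onI)
      fix u v
      assume uv: "u \<in> pverts G - W" "v \<in> pverts G - W"
        "{w \<in> W. (u, w) \<in> parcs G} = {w \<in> W. (v, w) \<in> parcs G}"
      then have "adj_rep G W u = adj_rep G W v" using outside[of u v] by simp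
      then show "u = v" using inj_onD[OF inj] uv by simp
    qed
  next
    assume inj: "inj_on (\<lambda>v. {w \<in> W. (v, w) \<in> parcs G}) (pverts G - W)"
    have "u = v" if "u \<in> pverts G" "v \<in> pverts G" "adj_rep G W u = adj_rep G W v" for u v
    proof (cases "u \<in> W \<or> v \<in> W")
      case True
      then show ?thesis by (rule inside[OF that(3)])
    next
      case False
      then show ?thesis using inj_onD[OF inj, of u v] outside[of u v] that by simp
    qed
    then show "adj_resolving G W"
      using assms by (simp add: adj_resolving_def inj_on_def)
  qed
qed

lemma card_inj_on_sets_le:
  fixes c :: "'a \<Rightarrow> 'b set"
  assumes fin: "finite U" "finite S"
    and inj: "inj_on c U"
    and sub: "\<And>u. u \<in> U \<Longrightarrow> c u \<subseteq> S"
    and deg: "\<And>s. s \<in> S \<Longrightarrow> card {u \<in> U. s \<in> c u} \<le> 2"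
  shows "2 * card U \<le> 3 * card S + 2"
proof -
  define Z where "Z = {u \<in> U. c u = {}}"
  define O1 where "O1 = {u \<in> U. is_singleton (c u)}"
  have finc: "finite (c u)" if "u \<in> U" for u
    using sub[OF that] fin(2) by (rule finite_subset)
  have "(\<Sum>u\<in>U. card (c u)) = (\<Sum>s\<in>S. card {u \<in> U. s \<in> c u})"
  proof -
    have "card (c u) = card {s \<in> S. s \<in> c u}" if "u \<in> U" for u
      using sub[OF that] by (intro arg_cong[where f = card]) auto
    then have "(\<Sum>u\<in>U. card (c u)) = (\<Sum>u\<in>U. card {s \<in> S. s \<in> c u})"
      by simp
    also have "\<dots> = (\<Sum>s\<in>S. card {u \<in> U. s \<in> c u})"
      using fin by (intro sum_multicount_gen) auto
    finally show ?thesis .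
  qed
  also have "\<dots> \<le> 2 * card S"
    using sum_bounded_above[of S "\<lambda>s. card {u \<in> U. s \<in> c u}" 2] deg by simp
  finally have incidences: "(\<Sum>u\<in>U. card (c u)) \<le> 2 * card S" .
  have "card Z \<le> card {{} :: 'b set}"
    using inj by (intro card_inj_on_le[of c]) (auto simp: Z_def inj_on_def)
  then have Z: "card Z \<le> 1" by simp
  have "card O1 \<le> card ((\<lambda>s. {s}) ` S)"
    using inj sub fin
    by (intro card_inj_on_le[of c]) (fastforce simp: O1_def inj_on_def is_singleton_def)+
  also have "\<dots> \<le> card S"
    by (rule card_image_le[OF fin(2)])
  finally have O1: "card O1 \<le> card S" .
  \<comment> \<open>Top every set up to weight 2: a singleton is short by 1, the empty set by 2. By
    injectivity the total shortage over \<open>U\<close> is at most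
    \<open>card S + 2\<close>.\<close>
  have "2 \<le> card (c u) + (of_bool (u \<in> O1) + 2 * of_bool (u \<in> Z))" if "u \<in> U" for u
  proof (cases "card (c u) = 0 \<or> card (c u) = 1")
    case True
    then show ?thesis
      using finc[OF that] that by (auto simp: Z_def O1_def is_singleton_altdef)
  qed simp
  then have "(\<Sum>u\<in>U. 2) \<le> (\<Sum>u\<in>U. card (c u) + (of_bool (u \<in> O1) + 2 * of_bool (u \<in> Z)))"
    by (rule sum_mono)
  also have "\<dots> = (\<Sum>u\<in>U. card (c u)) + card O1 + 2 * card Z"
  proof -
    have "U \<inter> O1 = O1" "U \<inter> Z = Z" by (auto simp: O1_def Z_def)
    then show ?thesis
      using fin by (simp add: sum.distrib of_bool_def sum.If_cases flip: sum_distrib_left)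
  qed
  finally show ?thesis
    using incidences Z O1 by simp
qed

section \<open>Distances\<close>

lemma (in wf_digraph) awalk_cost_1: "awalk_cost (\<lambda>_. 1) p = real (length p)"
  by (induct p) auto

lemma graph_dist_le:
  assumes "pair_wf_digraph G" "pre_digraph.awalk (with_proj G) u p v"
  shows "graph_dist G u v \<le> ereal (real (length p))"
proof -
  interpret pair_wf_digraph G by fact
  show ?thesis
    using min_cost_le_walk_cost[OF assms(2), of "\<lambda>_. 1"] by (simp add: graph_dist_def awalk_cost_1)
qed

text \<open>A potential that grows by at most 1 along each arc grows by at most the length of any
  walk. Without a walk from \<open>u\<close> to \<open>v\<close> the infimum is infinite and the
  bound is trivial.\<close>

lemma graph_dist_ge:
  fixes f :: "'a \<Rightarrow> nat"
  assumes "pair_wf_digraph G" "\<And>x y. (x, y) \<in> parcs G \<Longrightarrow> f y \<le> Suc (f x)"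
  shows "ereal (real (f v) - real (f u)) \<le> graph_dist G u v"
proof -
  interpret pair_wf_digraph G by fact
  have "f v \<le> f u + length p" if "awalk u p v" for p
    using that
  proof (induction p arbitrary: u)
    case Nil
    then show ?case by (simp add: awalk_Nil_iff)
  next
    case (Cons e p)
    then show ?case
      using assms(2)[of "fst e" "snd e"] by (fastforce simp: awalk_Cons_iff)
  qed
  then show ?thesis
    unfolding graph_dist_def \<mu>_def by (fastforce intro!: INF_greatest simp: awalk_cost_1)
qed

lemma length_rev_path [simp]: "length (rev_path p) = length p"
  by (induct p) auto

section \<open>Brooms\<close>

text \<open>Sending all leaves to 0 maps the broom onto a path, so that adjacency depends on levels
  alone.\<close>

definition level :: "nat \<Rightarrow> nat \<Rightarrow> nat" where
  "level D x = (if x \<le> D then x else 0)"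

text \<open>The leaves are \<open>0\<close> and the vertices beyond \<open>D\<close>.\<close>

definition broom :: "nat \<Rightarrow> nat \<Rightarrow> nat pair_pre_digraph" where
  "broom D n = \<lparr>pverts = {..<n},
     parcs = {(x, y). x < n \<and> y < n \<and> (level D y = Suc (level D x) \<or> level D x = Suc (level D y))}\<rparr>"

lemma pverts_broom [simp]: "pverts (broom D n) = {..<n}"
  by (simp add: broom_def)

lemma parcs_broom [simp]:
  "(x, y) \<in> parcs (broom D n) \<longleftrightarrow>
     x < n \<and> y < n \<and> (level D y = Suc (level D x) \<or> level D x = Suc (level D y))"
  by (simp add: broom_def)

lemma pair_graph_broom: "pair_graph (broom D n)"
proof -
  have sub: "parcs (broom D n) \<subseteq> {..<n} \<times> {..<n}" by auto
  show ?thesis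
  proof
    show "finite (parcs (broom D n))"
      by (rule finite_subset[OF sub]) auto
    show "symmetric (with_proj (broom D n))"
      unfolding symmetric_def by (auto simp: sym_def)
  qed (use sub in \<open>auto simp: level_def\<close>)
qed

text \<open>The walk climbs one level at a time through path vertices. Strictness matters: two
  distinct leaves have equal level but are not joined by a walk of length 0.\<close>

lemma ex_awalk_broom:
  assumes "D < n" "x < n" "y < n" "level D x < level D y"
  shows "\<exists>p. pre_digraph.awalk (with_proj (broom D n)) x p y \<and> length p = level D y - level D x"
proof -
  interpret pair_graph "broom D n" by (rule pair_graph_broom)
  show ?thesis
    using assms(2,4)
  proof (induction "level D y - level D x" arbitrary: x)
    case 0
    then show ?case by simp
  next
    case (Suc d)
    show ?case
    proof (cases "level D y = Suc (level D x)")
      case True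
      then have "awalk x [(x, y)] y"
        using Suc.prems \<open>y < n\<close> by (auto simp: awalk_Cons_iff awalk_Nil_iff)
      then show ?thesis using True by (intro exI[of _ "[(x, y)]"]) simp
    next
      case False
      define z where "z = Suc (level D x)"
      have "level D y \<le> D" by (simp add: level_def)
      then have z: "z < n" "level D z = Suc (level D x)"
        using Suc.prems \<open>D < n\<close> by (auto simp: z_def level_def)
      have "d = level D y - level D z" "level D z < level D y"
        using z Suc.hyps(2) Suc.prems False by simp_all
      then obtain p where "awalk z p y" "length p = level D y - level D z"
        using Suc.hyps(1) z(1) by blast
      then show ?thesis
        using Suc.prems z by (intro exI[of _ "(x, z) # p"]) (auto simp: awalk_Cons_iff)
    qed
  qed
qed

lemma diameter_broom:
  assumes "2 \<le> D" "D < n"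
  shows "diameter (broom D n) = ereal (real D)"
proof (rule antisym)
  interpret pair_graph "broom D n" by (rule pair_graph_broom)
  have wf: "pair_wf_digraph (broom D n)" by unfold_locales
  have lt: "\<exists>p. awalk x p y \<and> length p \<le> D" if "x < n" "y < n" "level D x < level D y" for x y
  proof -
    have "level D y \<le> D" by (simp add: level_def)
    then show ?thesis using ex_awalk_broom[OF \<open>D < n\<close> that] by fastforce
  qed
  have "\<exists>p. awalk x p y \<and> length p \<le> D" if "x < n" "y < n" for x y
  proof -
    consider "level D x < level D y" | "level D y < level D x" | "x = y"
      | "level D x = level D y" "x \<noteq> y" by linarith
    then show ?thesis
    proof cases
      case 1
      then show ?thesis using lt that by blast
    next
      case 2
      then obtain p where "awalk y p x" "length p \<le> D" using lt \<open>x < n\<close> \<open>y < n\<close> by blast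
      then show ?thesis by (intro exI[of _ "rev_path p"]) simp
    next
      case 3
      then show ?thesis using that by (intro exI[of _ "[]"]) (simp add: awalk_Nil_iff)
    next
      case 4
      \<comment> \<open>Distinct vertices of equal level are leaves and meet at 1; the resulting
        walk has length 2, hence the assumption \<open>2 \<le> D\<close>.\<close>
      then have "level D x = 0" "level D y = 0" by (auto simp: level_def split: if_splits)
      then have "awalk x [(x, 1), (1, y)] y"
        using that assms by (auto simp: awalk_Cons_iff awalk_Nil_iff level_def)
      then show ?thesis using \<open>2 \<le> D\<close> by (intro exI[of _ "[(x, 1), (1, y)]"]) simp
    qed
  qed
  then have "graph_dist (broom D n) x y \<le> ereal (real D)" if "x < n" "y < n" for x y
    using graph_dist_le[OF wf] that by (meson ereal_less_eq(3) of_nat_le_iff order_trans)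
  then show "diameter (broom D n) \<le> ereal (real D)"
    unfolding diameter_def by (auto intro!: SUP_least)
  have "ereal (real D) \<le> graph_dist (broom D n) 0 D"
  proof -
    have "level D D = D" "level D 0 = 0" by (simp_all add: level_def)
    then show ?thesis using graph_dist_ge[OF wf, of "level D" D 0] by force
  qed
  also have "\<dots> \<le> diameter (broom D n)"
    unfolding diameter_def using assms by (intro SUP_upper2[of "(0, D)"]) auto
  finally show "ereal (real D) \<le> diameter (broom D n)" .
qed

text \<open>Here \<open>a\<close> counts the leaves missing from \<open>W\<close> and
  \<open>s\<close> the elements of \<open>W\<close> in \<open>{1..D}\<close>. Keeping
  \<open>a\<close> explicit matters: a missing leaf saves one element of \<open>W\<close> but
  tightens the bound on \<open>s\<close>.\<close>

lemma card_adj_resolving_broom: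
  assumes "1 \<le> D" "D < n" and W: "adj_resolving (broom D n) W"
  obtains a s where "a \<le> 1" "card W + a = s + (n - D)" "2 * D + 2 * a \<le> 5 * s + 4"
proof -
  define T where "T = insert 0 {Suc D..<n}"
  define S where "S = W \<inter> {1..D}"
  \<comment> \<open>Vertex 1 is left out because it is adjacent to the leaves, which lie outside
    \<open>S\<close>; all other vertices have their neighbours in \<open>{1..D}\<close>.\<close>
  define U where "U = (T - W) \<union> ({2..D} - W)"
  define c where "c = (\<lambda>v. {w \<in> W. (v, w) \<in> parcs (broom D n)})"
  have Wn: "W \<subseteq> {..<n}" using W by (simp add: adj_resolving_def)
  then have finW: "finite W" by (rule finite_subset) simp
  have inj: "inj_on c ({..<n} - W)"
    using adj_resolving_iff_inj_on_nbhd[of W "broom D n"] W Wn unfolding c_def by simp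
  have finT: "finite T" and cardT: "card T = n - D"
    using \<open>D < n\<close> by (auto simp: T_def)
  have T_level: "x \<in> T \<longleftrightarrow> x < n \<and> level D x = 0" for x
    using \<open>D < n\<close> by (auto simp: T_def level_def)
  have cT: "c t = {1} \<inter> W" if "t \<in> T" for t
    using that assms Wn by (auto simp: c_def T_level level_def split: if_splits)
  have "t = t'" if "t \<in> T - W" "t' \<in> T - W" for t t'
    using inj_onD[OF inj, of t t'] cT that by (auto simp: T_level)
  then have a: "card (T - W) \<le> 1"
    using finT by (simp add: card_le_Suc0_iff_eq)
  have "2 * card U \<le> 3 * card S + 2"
  proof (rule card_inj_on_sets_le[of _ _ c])
    show "finite U" "finite S" using finT finW by (auto simp: U_def S_def)
    have "U \<subseteq> {..<n} - W" using \<open>D < n\<close> by (auto simp: U_def T_def)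
    then show "inj_on c U" by (rule inj_on_subset[OF inj])
  next
    fix u assume "u \<in> U"
    then show "c u \<subseteq> S"
      using \<open>D < n\<close> by (auto simp: c_def U_def S_def T_level level_def split: if_splits)
  next
    fix s assume s: "s \<in> S"
    show "card {u \<in> U. s \<in> c u} \<le> 2"
    proof (cases "s = 1")
      case True
      \<comment> \<open>Vertex 1 may have many neighbours, but at most one of its leaves is outside
        \<open>W\<close>.\<close>
      have "{u \<in> U. s \<in> c u} \<subseteq> insert 2 (T - W)"
        using \<open>D < n\<close> \<open>1 \<le> D\<close> True by (auto simp: c_def U_def level_def split: if_splits)
      then have "card {u \<in> U. s \<in> c u} \<le> card (insert 2 (T - W))"
        using finT by (intro card_mono) auto
      also have "\<dots> \<le> Suc (card (T - W))"
        by (rule card_insert_le_m1) auto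
      finally show ?thesis using a by simp
    next
      case False
      have "{u \<in> U. s \<in> c u} \<subseteq> {s - 1, s + 1}"
        using s False by (auto simp: c_def S_def level_def split: if_splits)
      then have "card {u \<in> U. s \<in> c u} \<le> card {s - 1, s + 1}"
        by (intro card_mono) auto
      also have "\<dots> \<le> 2" by (simp add: card_insert_if)
      finally show ?thesis .
    qed
  qed
  moreover have "card U = card (T - W) + card ({2..D} - W)"
    unfolding U_def using finT by (intro card_Un_disjoint) (auto simp: T_def)
  moreover have "D - 1 - card S \<le> card ({2..D} - W)"
  proof -
    have "card {2..D} - card S \<le> card ({2..D} - S)"
      using finW by (intro diff_card_le_card_Diff) (simp add: S_def)
    also have "{2..D} - S = {2..D} - W" by (auto simp: S_def)
    finally show ?thesis by simp
  qed
  \<comment> \<open>With \<open>a = card (T - W)\<close> and \<open>s = card S\<close>, this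
    rearranges \<open>2 * (a + (D - 1 - s)) \<le> 3 * s + 2\<close>.\<close>
  ultimately have bound: "2 * D + 2 * card (T - W) \<le> 5 * card S + 4"
    by linarith
  have "W = S \<union> (T \<inter> W)" using Wn by (auto simp: S_def T_def)
  then have "card W = card S + card (T \<inter> W)"
    using finW finT
    by (metis (no_types, lifting) S_def T_def card_Un_disjoint finite_Int disjoint_iff
        Int_iff atLeastAtMost_iff atLeastLessThan_iff insert_iff not_less_eq_eq not_one_le_zero)
  moreover have "card (T \<inter> W) + card (T - W) = card T"
    using finT by (metis card_Diff_subset_Int card_mono finite_Int inf_le1 le_add_diff_inverse)
  ultimately show ?thesis
    using that[OF a _ bound] cardT by simp
qed

text \<open>Take all leaves except 0 and the path vertices congruent to 2 or 4 modulo 5;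
  \<open>k'\<close> counts those congruent to 2, one more when \<open>D = 5 * k + 2\<close>. A path
  vertex \<open>v\<close> outside \<open>P\<close> sees in \<open>P\<close> only
  \<open>v + 1\<close>, both \<open>v - 1\<close> and \<open>v + 1\<close>, or only
  \<open>v - 1\<close>, for residues 1, 3, 0 respectively; the sole exception is 0, which sees
  nothing.\<close>

lemma ex_adj_resolving_broom:
  assumes "D = 5 * k \<and> k' = k \<or> D = 5 * k + 2 \<and> k' = Suc k" "D < n"
  shows "\<exists>W. adj_resolving (broom D n) W \<and> card W \<le> n - D - 1 + k + k'"
proof -
  define P where "P = (\<lambda>j. 5 * j + 4) ` {..<k} \<union> (\<lambda>j. 5 * j + 2) ` {..<k'}"
  define W where "W = {Suc D..<n} \<union> P"
  have P: "i \<in> P \<longleftrightarrow> i \<le> D \<and> (i mod 5 = 2 \<or> i mod 5 = 4)" for i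
  proof
    assume "i \<in> P"
    moreover have "(5 * j + 2) mod 5 = 2" "(5 * j + 4) mod 5 = 4" for j :: nat
      by presburger+
    ultimately show "i \<le> D \<and> (i mod 5 = 2 \<or> i mod 5 = 4)"
      using assms(1) by (auto simp: P_def)
  next
    assume i: "i \<le> D \<and> (i mod 5 = 2 \<or> i mod 5 = 4)"
    define j where "j = i div 5"
    have "i = 5 * j + i mod 5" by (simp add: j_def)
    then consider "i = 5 * j + 2" "j < k'" | "i = 5 * j + 4" "j < k"
      using i assms(1) by linarith
    then show "i \<in> P"
      unfolding P_def by cases blast+
  qed
  define c where "c = (\<lambda>v. {w \<in> W. (v, w) \<in> parcs (broom D n)})"
  have "card W \<le> card {Suc D..<n} + card P"
    unfolding W_def by (rule card_Un_le)
  also have "card P \<le> card ((\<lambda>j. 5 * j + 4) ` {..<k}) + card ((\<lambda>j. 5 * j + 2) ` {..<k'})"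
    unfolding P_def by (rule card_Un_le)
  also have "\<dots> \<le> k + k'"
    by (intro add_mono order_trans[OF card_image_le]) auto
  finally have card: "card W \<le> n - D - 1 + k + k'" by simp
  have c: "w \<in> c v \<longleftrightarrow> w = Suc v \<or> v = Suc w" if "v \<le> D" "w \<in> P" for v w
    using that assms(2) by (auto simp: c_def W_def P level_def)
  have "c u \<noteq> c v" if "u < v" "v \<le> D" "u \<notin> P" "v \<notin> P" for u v
  proof -
    \<comment> \<open>This excludes \<open>v = D\<close> for residues 1 and 3, so
      \<open>Suc v\<close> is still on the path; it separates \<open>v\<close> from every smaller
      \<open>u\<close>.\<close>
    have D: "D mod 5 = 0 \<or> D mod 5 = 2" using assms(1) by presburger
    have v: "v mod 5 = 0 \<or> v mod 5 = 1 \<or> v mod 5 = 3"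
      using \<open>v \<le> D\<close> \<open>v \<notin> P\<close> unfolding P by linarith
    show ?thesis
    proof (cases "v mod 5 = 0")
      case False
      then have "Suc v \<in> P"
        using v D \<open>v \<le> D\<close> unfolding P by (cases "v = D") (auto simp: mod_Suc)
      then have "Suc v \<in> c v" "Suc v \<notin> c u" using c that by auto
      then show ?thesis by blast
    next
      case True
      \<comment> \<open>Since \<open>v\<close> is positive, its predecessor \<open>w\<close> is in
        \<open>P\<close> and separates \<open>v\<close> from \<open>u\<close>, unless
        \<open>u = v - 2\<close>. In that case \<open>u\<close> has residue 3 and its own
        predecessor separates them.\<close>
      then obtain w where w: "v = Suc w" "w mod 5 = 4"
        using \<open>u < v\<close> by (cases v) (auto simp: mod_Suc split: if_splits)
      then have "w \<in> P" using \<open>v \<le> D\<close> unfolding P by simp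
      show ?thesis
      proof (cases "w = Suc u")
        case True
        then have "u mod 5 = 3" using w(2) by (auto simp: mod_Suc split: if_splits)
        then obtain x where x: "u = Suc x" "x mod 5 = 2"
          by (cases u) (auto simp: mod_Suc split: if_splits)
        then have "x \<in> P" using \<open>u < v\<close> \<open>v \<le> D\<close> unfolding P by simp
        then have "x \<in> c u" "x \<notin> c v" using c[of _ x] \<open>u < v\<close> \<open>v \<le> D\<close> x(1) by auto
        then show ?thesis by blast
      next
        case False
        then have "w \<in> c v" "w \<notin> c u"
          using c[of _ w] \<open>w \<in> P\<close> w(1) \<open>u < v\<close> \<open>v \<le> D\<close> \<open>u \<notin> P\<close> by auto
        then show ?thesis by blast
      qed
    qed
  qed
  then have neq: "c u \<noteq> c v" if "u \<noteq> v" "u \<le> D" "v \<le> D" "u \<notin> P" "v \<notin> P" for u v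
    using that by (metis linorder_neqE_nat)
  have "inj_on c (pverts (broom D n) - W)"
  proof (rule inj_onI)
    fix u v
    assume "u \<in> pverts (broom D n) - W" "v \<in> pverts (broom D n) - W" "c u = c v"
    then show "u = v" using neq[of u v] by (force simp: W_def)
  qed
  moreover have "W \<subseteq> pverts (broom D n)"
    using assms(2) by (auto simp: W_def P)
  ultimately have "adj_resolving (broom D n) W"
    using adj_resolving_iff_inj_on_nbhd unfolding c_def by blast
  then show ?thesis using card by blast
qed

lemma adj_dim_broom:
  assumes "D = 5 * k \<and> k' = k \<or> D = 5 * k + 2 \<and> k' = Suc k" "1 \<le> D" "D < n"
  shows "adj_dim (broom D n) = n - D - 1 + k + k'"
proof -
  have ge: "n - D - 1 + k + k' \<le> card W" if W: "adj_resolving (broom D n) W" for W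
  proof -
    obtain a s where "a \<le> 1" "card W + a = s + (n - D)" "2 * D + 2 * a \<le> 5 * s + 4"
      using card_adj_resolving_broom[OF assms(2,3) W] .
    \<comment> \<open>Integrality of \<open>s\<close> is used: \<open>s \<ge> 2 * k\<close> if
      \<open>D = 5 * k\<close>, whatever \<open>a\<close> is, and \<open>s \<ge> 2 * k + a\<close>
      if \<open>D = 5 * k + 2\<close>.\<close>
    moreover from this assms(1) have "k + k' + a \<le> s + 1"
      by (elim disjE conjE) linarith+
    ultimately show ?thesis using \<open>D < n\<close> by linarith
  qed
  moreover obtain W where "adj_resolving (broom D n) W" "card W \<le> n - D - 1 + k + k'"
    using ex_adj_resolving_broom[OF assms(1,3)] by blast
  ultimately show ?thesis
    unfolding adj_dim_def by (intro Least_equality) (auto intro!: exI[of _ W] antisym)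
qed

theorem theorem2p2:
  fixes k D n :: nat
  assumes "k > 0"
    and "D \<in> {5 * k, 5 * k + 2}"
    and "n \<ge> D + 1"
  shows "\<exists>G :: nat pair_pre_digraph. pair_graph G \<and> card (pverts G) = n \<and>
    diameter G = ereal (real D) \<and>
    int (adj_dim G) = int n - int D - 1 + \<lfloor>(2 * real D + 4) / 5\<rfloor>"
proof -
  define k' where "k' = (if D = 5 * k then k else Suc k)"
  have D: "D = 5 * k \<and> k' = k \<or> D = 5 * k + 2 \<and> k' = Suc k"
    using assms(2) by (auto simp: k'_def)
  have "2 \<le> D" "1 \<le> D" "D < n" using assms by auto
  \<comment> \<open>The quotient is \<open>2 * k + 4 / 5\<close> or
    \<open>2 * k + 8 / 5\<close>.\<close>
  have floor: "\<lfloor>(2 * real D + 4) / 5\<rfloor> = int (k + k')"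
    using D by (intro floor_unique) (auto simp: field_simps)
  show ?thesis
    using pair_graph_broom diameter_broom[OF \<open>2 \<le> D\<close> \<open>D < n\<close>]
      adj_dim_broom[OF D \<open>1 \<le> D\<close> \<open>D < n\<close>] floor \<open>D < n\<close>
    by (intro exI[of _ "broom D n"]) (simp add: of_nat_diff)
qed

end
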